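(* Let $\mathrm{I}$ be a set, $\mathbf{C}$ a category and $\mathbf{G}:\mathbf{GLD}(\mathrm{I})\to\mathbf{C}$ a $\mathbf{C}$-gluing data functor. Let $L$ be an object of $\mathbf{C}$ and $\pi_L=(\pi_{L_a}:L\to\mathbf{G}(a))_a$ a family of morphisms of $\mathbf{C}$ indexed by the objects $a$ of $\mathbf{GLD}(\mathrm{I})$. Then $L$ is a glued-up $\mathbf{C}$-object along $\mathbf{G}$ through $\pi_L$ if and only if the following properties hold: 1. $\pi_{L_{[i,j]}}=\mathbf{G}(\eta_{i,[i,j]})\circ\pi_{L_i}$ for all $i,j\in\mathrm{I}$; 2. $\pi_{L_{[i,j,k]}}=\mathbf{G}(\eta_{[i,n],[i,j,k]})\circ\pi_{L_{[i,n]}}$ for all $i,j,k\in\mathrm{I}$ and $n\in\{j,k\}$; 3. $(L,(\pi_{L_i})_{i\in\mathrm{I}})$ is the limit of the diagram formed by the morphisms $$\mathbf{G}(\eta_{i,[i,j]}):\mathbf{G}(i)\to\mathbf{G}([i,j])\quad\text{and}\quad \mathbf{G}(\tau_{[i,j]}\circ\eta_{j,[j,i]}):\mathbf{G}(j)\to\mathbf{G}([i,j]),\qquad i,j\in\mathrm{I}.$$ That is, $\mathbf{G}(\eta_{i,[i,j]})\circ\pi_{L_i}=\mathbf{G}(\tau_{[i,j]}\circ\eta_{j,[j,i]})\circ\pi_{L_j}$ for all $i,j\in\mathrm{I}$, and for every object $L'$ with morphisms $\pi'_i:L'\to\mathbf{G}(i)$ ($i\in\mathrm{I}$) satisfying the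 same equalities for all $i,j\in\mathrm{I}$ there is a unique morphism $\mu:L'\to L$ with $\pi_{L_i}\circ\mu=\pi'_i$ for all $i\in\mathrm{I}$.
   Context: Gluing Data category. For a set $\mathrm{I}$, the category $\mathbf{GLD}(\mathrm{I})$ is defined as follows. Its objects are the equivalence classes of elements of $\mathrm{I}\cup\mathrm{I}^2\cup\mathrm{I}^3$ (disjoint union) for the equivalence relation generated by $i\sim(i,i)$, $i\sim(i,i,i)$, $(i,j,k)\sim(i,k,j)$, $(i,i,j)\sim(i,j)$, $(i,j,j)\sim(i,j)$ for $i,j,k\in\mathrm{I}$. The classes of $i$, $(i,j)$, $(i,j,k)$ are written $[i]$ (or simply $i$), $[i,j]$, $[i,j,k]$. Between any two objects there is at most one morphism. The morphisms are the identities, the following morphisms for all $i,j,k\in\mathrm{I}$ and $n\in\{j,k\}$, and all their composites: $\eta_{i,[i,j]}:i\to[i,j]$; $\tau_{[i,j]}:[j,i]\to[i,j]$; $\eta_{[i,n],[i,j,k]}:[i,n]\to[i,j,k]$; $\tau_{k_{[i,j]}}:[j,i,k]\to[i,j,k]$. Gluing data functor. A $\mathbf{C}$-gluing data functor of type $\mathrm{I}$ is a functor $\mathbf{G}:\mathbf{GLD}(\mathrm{I})\to\mathbf{C}$ such that, for all distinct $i,j,k\in\mathrm{I}$, the object $\mathbf{G}([i,j,k])$ with the morphisms $\mathbf{G}(\eta_{[i,j],[i,j,k]})$ and $\mathbf{G}(\eta_{[i,k],[i,j,k]})$ is a pushout in $\mathbf{C}$ of $\mathbf{G}(\eta_{i,[i,j]})$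 and $\mathbf{G}(\eta_{i,[i,k]})$. Glued-up object. $L$ is a glued-up $\mathbf{C}$-object along $\mathbf{G}$ through $\pi_L$ if the limit of $\mathbf{G}$ exists and $(L,\pi_L)$ is a cone over $\mathbf{G}$ isomorphic, as a cone, to $\lim\mathbf{G}$ (equivalently, $(L,\pi_L)$ is a terminal cone over $\mathbf{G}$). *)

theory Defs
  imports Main
begin

section \<open>Categories, functors, limits and pushouts\<close>

text \<open>
  The object and arrow maps are total on the underlying types; only their values on
  \<open>Obj\<close>, \<open>Mor\<close> and on composable pairs are meaningful.
\<close>

record ('o, 'm) cat =
  Obj :: "'o set"
  Mor :: "'m set"
  Src :: "'m \<Rightarrow> 'o"
  Tgt :: "'m \<Rightarrow> 'o"
  Ident :: "'o \<Rightarrow> 'm"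
  Comp :: "'m \<Rightarrow> 'm \<Rightarrow> 'm"  (infixl "\<cdot>\<index>" 70)

definition hom :: "('o, 'm) cat \<Rightarrow> 'o \<Rightarrow> 'o \<Rightarrow> 'm set" where
  "hom C a b = {f \<in> Mor C. Src C f = a \<and> Tgt C f = b}"

locale category =
  fixes C :: "('o, 'm) cat" (structure)
  assumes src_obj: "f \<in> Mor C \<Longrightarrow> Src C f \<in> Obj C"
    and tgt_obj: "f \<in> Mor C \<Longrightarrow> Tgt C f \<in> Obj C"
    and ident_hom: "a \<in> Obj C \<Longrightarrow> Ident C a \<in> hom C a a"
    and comp_hom: "f \<in> hom C a b \<Longrightarrow> g \<in> hom C b c \<Longrightarrow> g \<cdot> f \<in> hom C a c"
    and comp_ident: "f \<in> hom C a b \<Longrightarrow> f \<cdot> Ident C a = f"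
    and ident_comp: "f \<in> hom C a b \<Longrightarrow> Ident C b \<cdot> f = f"
    and comp_assoc: "f \<in> hom C a b \<Longrightarrow> g \<in> hom C b c \<Longrightarrow> h \<in> hom C c d \<Longrightarrow>
      (h \<cdot> g) \<cdot> f = h \<cdot> (g \<cdot> f)"

record ('o1, 'm1, 'o2, 'm2) fctr =
  omap :: "'o1 \<Rightarrow> 'o2"
  amap :: "'m1 \<Rightarrow> 'm2"

locale cat_functor = A: category A + B: category B
  for A :: "('o1, 'm1) cat" and B :: "('o2, 'm2) cat" +
  fixes F :: "('o1, 'm1, 'o2, 'm2) fctr"
  assumes omap_obj: "a \<in> Obj A \<Longrightarrow> omap F a \<in> Obj B"
    and amap_hom: "f \<in> hom A a b \<Longrightarrow> amap F f \<in> hom B (omap F a) (omap F b)"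
    and amap_ident: "a \<in> Obj A \<Longrightarrow> amap F (Ident A a) = Ident B (omap F a)"
    and amap_comp: "f \<in> hom A a b \<Longrightarrow> g \<in> hom A b c \<Longrightarrow>
      amap F (g \<cdot>\<^bsub>A\<^esub> f) = amap F g \<cdot>\<^bsub>B\<^esub> amap F f"

definition is_cone ::
  "('o1, 'm1) cat \<Rightarrow> ('o2, 'm2) cat \<Rightarrow> ('o1, 'm1, 'o2, 'm2) fctr \<Rightarrow> 'o2 \<Rightarrow> ('o1 \<Rightarrow> 'm2) \<Rightarrow> bool" where
  "is_cone J C F L p \<longleftrightarrow>
     L \<in> Obj C \<and>
     (\<forall>a\<in>Obj J. p a \<in> hom C L (omap F a)) \<and>
     (\<forall>a b. \<forall>f\<in>hom J a b. amap F f \<cdot>\<^bsub>C\<^esub> p a = p b)"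

definition cone_hom ::
  "('o1, 'm1) cat \<Rightarrow> ('o2, 'm2) cat \<Rightarrow> 'o2 \<Rightarrow> ('o1 \<Rightarrow> 'm2) \<Rightarrow> 'o2 \<Rightarrow> ('o1 \<Rightarrow> 'm2) \<Rightarrow> 'm2 set" where
  "cone_hom J C L p M q = {f \<in> hom C L M. \<forall>a\<in>Obj J. q a \<cdot>\<^bsub>C\<^esub> f = p a}"

definition cone_iso ::
  "('o1, 'm1) cat \<Rightarrow> ('o2, 'm2) cat \<Rightarrow> 'o2 \<Rightarrow> ('o1 \<Rightarrow> 'm2) \<Rightarrow> 'o2 \<Rightarrow> ('o1 \<Rightarrow> 'm2) \<Rightarrow> bool" where
  "cone_iso J C L p M q \<longleftrightarrow>
     (\<exists>f\<in>cone_hom J C L p M q. \<exists>g\<in>cone_hom J C M q L p.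
        g \<cdot>\<^bsub>C\<^esub> f = Ident C L \<and> f \<cdot>\<^bsub>C\<^esub> g = Ident C M)"

definition is_limit ::
  "('o1, 'm1) cat \<Rightarrow> ('o2, 'm2) cat \<Rightarrow> ('o1, 'm1, 'o2, 'm2) fctr \<Rightarrow> 'o2 \<Rightarrow> ('o1 \<Rightarrow> 'm2) \<Rightarrow> bool" where
  "is_limit J C F M q \<longleftrightarrow>
     is_cone J C F M q \<and> (\<forall>L p. is_cone J C F L p \<longrightarrow> (\<exists>!f. f \<in> cone_hom J C L p M q))"

text \<open>\<open>is_pushout C f g P u v\<close>: the object \<open>P\<close> with \<open>u\<close>, \<open>v\<close> (out of the targets of
  \<open>f\<close> and \<open>g\<close> respectively) is a pushout of the span \<open>f\<close>, \<open>g\<close>.\<close>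

definition is_pushout :: "('o, 'm) cat \<Rightarrow> 'm \<Rightarrow> 'm \<Rightarrow> 'o \<Rightarrow> 'm \<Rightarrow> 'm \<Rightarrow> bool" where
  "is_pushout C f g P u v \<longleftrightarrow>
     f \<in> Mor C \<and> g \<in> Mor C \<and> Src C f = Src C g \<and> P \<in> Obj C \<and>
     u \<in> hom C (Tgt C f) P \<and> v \<in> hom C (Tgt C g) P \<and> u \<cdot>\<^bsub>C\<^esub> f = v \<cdot>\<^bsub>C\<^esub> g \<and>
     (\<forall>Q\<in>Obj C. \<forall>u'\<in>hom C (Tgt C f) Q. \<forall>v'\<in>hom C (Tgt C g) Q.
        u' \<cdot>\<^bsub>C\<^esub> f = v' \<cdot>\<^bsub>C\<^esub> g \<longrightarrow>
        (\<exists>!w. w \<in> hom C P Q \<and> w \<cdot>\<^bsub>C\<^esub> u = u' \<and> w \<cdot>\<^bsub>C\<^esub> v = v'))"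


section \<open>The gluing data category\<close>

text \<open>The disjoint union of \<open>I\<close>, \<open>I\<^sup>2\<close> and \<open>I\<^sup>3\<close>.\<close>

datatype 'i word = W1 'i | W2 'i 'i | W3 'i 'i 'i

definition words :: "'i set \<Rightarrow> 'i word set" where
  "words I = {w. set_word w \<subseteq> I}"

inductive_set word_eq :: "'i set \<Rightarrow> ('i word \<times> 'i word) set" for I :: "'i set" where
  refl: "w \<in> words I \<Longrightarrow> (w, w) \<in> word_eq I"
| sym: "(v, w) \<in> word_eq I \<Longrightarrow> (w, v) \<in> word_eq I"
| trans: "(u, v) \<in> word_eq I \<Longrightarrow> (v, w) \<in> word_eq I \<Longrightarrow> (u, w) \<in> word_eq I"
| i_ii: "i \<in> I \<Longrightarrow> (W1 i, W2 i i) \<in> word_eq I"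
| i_iii: "i \<in> I \<Longrightarrow> (W1 i, W3 i i i) \<in> word_eq I"
| ijk_ikj: "i \<in> I \<Longrightarrow> j \<in> I \<Longrightarrow> k \<in> I \<Longrightarrow> (W3 i j k, W3 i k j) \<in> word_eq I"
| iij_ij: "i \<in> I \<Longrightarrow> j \<in> I \<Longrightarrow> (W3 i i j, W2 i j) \<in> word_eq I"
| ijj_ij: "i \<in> I \<Longrightarrow> j \<in> I \<Longrightarrow> (W3 i j j, W2 i j) \<in> word_eq I"

type_synonym 'i gobj = "'i word set"

definition cls1 :: "'i set \<Rightarrow> 'i \<Rightarrow> 'i gobj" where
  "cls1 I i = word_eq I `` {W1 i}"

definition cls2 :: "'i set \<Rightarrow> 'i \<Rightarrow> 'i \<Rightarrow> 'i gobj" where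
  "cls2 I i j = word_eq I `` {W2 i j}"

definition cls3 :: "'i set \<Rightarrow> 'i \<Rightarrow> 'i \<Rightarrow> 'i \<Rightarrow> 'i gobj" where
  "cls3 I i j k = word_eq I `` {W3 i j k}"

text \<open>
  There is at most one morphism between two objects, so a morphism is represented by the pair
  of its source and its target:
  \<open>eta1 I i j\<close> is $\eta_{i,[i,j]}$, \<open>tau2 I i j\<close> is $\tau_{[i,j]}$,
  \<open>eta2 I i n j k\<close> is $\eta_{[i,n],[i,j,k]}$ and \<open>tau3 I k i j\<close> is $\tau_{k_{[i,j]}}$.
\<close>

type_synonym 'i gmor = "'i gobj \<times> 'i gobj"

definition eta1 :: "'i set \<Rightarrow> 'i \<Rightarrow> 'i \<Rightarrow> 'i gmor" where
  "eta1 I i j = (cls1 I i, cls2 I i j)"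

definition tau2 :: "'i set \<Rightarrow> 'i \<Rightarrow> 'i \<Rightarrow> 'i gmor" where
  "tau2 I i j = (cls2 I j i, cls2 I i j)"

definition eta2 :: "'i set \<Rightarrow> 'i \<Rightarrow> 'i \<Rightarrow> 'i \<Rightarrow> 'i \<Rightarrow> 'i gmor" where
  "eta2 I i n j k = (cls2 I i n, cls3 I i j k)"

definition tau3 :: "'i set \<Rightarrow> 'i \<Rightarrow> 'i \<Rightarrow> 'i \<Rightarrow> 'i gmor" where
  "tau3 I k i j = (cls3 I j i k, cls3 I i j k)"

inductive_set gmors :: "'i set \<Rightarrow> 'i gmor set" for I :: "'i set" where
  ident: "a \<in> words I // word_eq I \<Longrightarrow> (a, a) \<in> gmors I"
| eta1: "i \<in> I \<Longrightarrow> j \<in> I \<Longrightarrow> eta1 I i j \<in> gmors I"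
| tau2: "i \<in> I \<Longrightarrow> j \<in> I \<Longrightarrow> tau2 I i j \<in> gmors I"
| eta2: "i \<in> I \<Longrightarrow> j \<in> I \<Longrightarrow> k \<in> I \<Longrightarrow> n \<in> {j, k} \<Longrightarrow> eta2 I i n j k \<in> gmors I"
| tau3: "i \<in> I \<Longrightarrow> j \<in> I \<Longrightarrow> k \<in> I \<Longrightarrow> tau3 I k i j \<in> gmors I"
| comp: "(a, b) \<in> gmors I \<Longrightarrow> (b, c) \<in> gmors I \<Longrightarrow> (a, c) \<in> gmors I"

definition GLD :: "'i set \<Rightarrow> ('i gobj, 'i gmor) cat" where
  "GLD I = \<lparr>Obj = words I // word_eq I, Mor = gmors I, Src = fst, Tgt = snd,
            Ident = (\<lambda>a. (a, a)), Comp = (\<lambda>g f. (fst f, snd g))\<rparr>"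

lemma word_eq_words: "(v, w) \<in> word_eq I \<Longrightarrow> v \<in> words I \<and> w \<in> words I"
  by (induction rule: word_eq.induct) (auto simp: words_def)

lemma equiv_word_eq: "equiv (words I) (word_eq I)"
  by (rule equivI)
    (auto simp: refl_on_def sym_def trans_def dest: word_eq_words intro: word_eq.intros)

lemma cls_obj:
  "i \<in> I \<Longrightarrow> cls1 I i \<in> Obj (GLD I)"
  "i \<in> I \<Longrightarrow> j \<in> I \<Longrightarrow> cls2 I i j \<in> Obj (GLD I)"
  "i \<in> I \<Longrightarrow> j \<in> I \<Longrightarrow> k \<in> I \<Longrightarrow> cls3 I i j k \<in> Obj (GLD I)"
  by (auto simp: cls1_def cls2_def cls3_def GLD_def words_def intro!: quotientI)

lemma gmors_obj: "(a, b) \<in> gmors I \<Longrightarrow> a \<in> Obj (GLD I) \<and> b \<in> Obj (GLD I)"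
proof (induction "(a, b)" arbitrary: a b rule: gmors.induct)
  case (ident a)
  then show ?case by (simp add: GLD_def)
qed (auto simp: eta1_def tau2_def eta2_def tau3_def cls_obj)

lemma category_GLD: "category (GLD I)"
  by unfold_locales
    (auto simp: hom_def GLD_def dest: gmors_obj[unfolded GLD_def] intro: gmors.intros)


section \<open>Gluing data functors and glued-up objects\<close>

locale gluing_data_functor = cat_functor "GLD I" C G
  for I :: "'i set" and C :: "('o, 'm) cat"
    and G :: "('i gobj, 'i gmor, 'o, 'm) fctr" +
  assumes pushout: "i \<in> I \<Longrightarrow> j \<in> I \<Longrightarrow> k \<in> I \<Longrightarrow> i \<noteq> j \<Longrightarrow> i \<noteq> k \<Longrightarrow> j \<noteq> k \<Longrightarrow>
    is_pushout C (amap G (eta1 I i j)) (amap G (eta1 I i k))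
      (omap G (cls3 I i j k)) (amap G (eta2 I i j j k)) (amap G (eta2 I i k j k))"

definition glued_up ::
  "'i set \<Rightarrow> ('o, 'm) cat \<Rightarrow> ('i gobj, 'i gmor, 'o, 'm) fctr \<Rightarrow> 'o \<Rightarrow> ('i gobj \<Rightarrow> 'm) \<Rightarrow> bool" where
  "glued_up I C G L p \<longleftrightarrow>
     is_cone (GLD I) C G L p \<and>
     (\<exists>M q. is_limit (GLD I) C G M q \<and> cone_iso (GLD I) C L p M q)"

end

theory Submission
  imports Defs
begin

text \<open>
  Every relation generating \<open>word_eq\<close> preserves the first letter of a word, so an object \<open>a\<close> of
  \<open>GLD I\<close> has a well-defined leading index \<open>i\<close>, and the maps \<open>\<eta>\<close> provide a morphism \<open>[i] \<rightarrow> a\<close>.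
  A cone over \<open>G\<close> is therefore determined by its components at the objects \<open>[i]\<close>: the component
  at \<open>a\<close> is the one at \<open>[i]\<close> followed by \<open>G([i] \<rightarrow> a)\<close>.

  Conversely, a family of morphisms into the \<open>G([i])\<close> extends in this way to a cone as soon as it
  satisfies the equalities that live on the objects \<open>[i,j]\<close>. Indeed \<open>\<eta>\<close> keeps the leading
  index, so naturality along \<open>\<eta>\<close> is free; naturality along \<open>\<tau>\<^sub>[\<^sub>i\<^sub>,\<^sub>j\<^sub>]\<close> is the assumed equality; and
  since there is at most one morphism between two objects, the path
  \<open>[j] \<rightarrow> [j,i,k] \<rightarrow> [i,j,k]\<close> equals \<open>[j] \<rightarrow> [j,i] \<rightarrow> [i,j] \<rightarrow> [i,j,k]\<close>, which reduces naturality
  along the triple transitions to naturality along the double ones (lemma \<open>amap_extend_eq\<close>).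

  So cones with a given apex correspond bijectively, and compatibly with precomposition, to
  matching families (lemmas \<open>cone_matching\<close>, \<open>cone_extend\<close>, \<open>cone_hom_iff\<close>), and terminal
  objects on the two sides correspond (lemma \<open>is_limit_iff_universal_matching\<close>).
  The equalities for \<open>p\<close> at \<open>[i,j]\<close> and \<open>[i,j,k]\<close> say that \<open>p\<close> is the extension of its components
  at the objects \<open>[i]\<close>, and being glued up just means being a limit cone.
\<close>

section \<open>Cones isomorphic to a limit cone\<close>

lemma (in category) comp_assoc_hom:
  "f \<in> hom C a b \<Longrightarrow> g \<in> hom C b c \<Longrightarrow> h \<in> hom C c d \<Longrightarrow> h \<cdot> (g \<cdot> f) = (h \<cdot> g) \<cdot> f"
  by (simp add: comp_assoc)

context cat_functor
begin

lemma cone_hom_comp: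
  assumes r: "is_cone A B F N r" and q: "is_cone A B F M q" and p: "is_cone A B F L p"
    and h: "h \<in> cone_hom A B N r M q" and g: "g \<in> cone_hom A B M q L p"
  shows "g \<cdot>\<^bsub>B\<^esub> h \<in> cone_hom A B N r L p"
proof -
  have h': "h \<in> hom B N M" and g': "g \<in> hom B M L"
    using h g by (auto simp: cone_hom_def)
  have "p a \<cdot>\<^bsub>B\<^esub> (g \<cdot>\<^bsub>B\<^esub> h) = r a" if a: "a \<in> Obj A" for a
  proof -
    have "p a \<in> hom B L (omap F a)"
      using p a by (simp add: is_cone_def)
    then have "p a \<cdot>\<^bsub>B\<^esub> (g \<cdot>\<^bsub>B\<^esub> h) = (p a \<cdot>\<^bsub>B\<^esub> g) \<cdot>\<^bsub>B\<^esub> h"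
      using B.comp_assoc_hom h' g' by blast
    then show ?thesis
      using h g a by (simp add: cone_hom_def)
  qed
  then show ?thesis
    using B.comp_hom[OF h' g'] by (simp add: cone_hom_def)
qed

text \<open>Being a limit is invariant under isomorphism of cones: the mediating morphism into \<open>M\<close> is
  transported to \<open>L\<close> by \<open>g\<close>, and any other candidate \<open>k\<close> satisfies \<open>k = g (f k)\<close>, where \<open>f k\<close> is
  forced by uniqueness for \<open>M\<close>.\<close>

lemma is_limit_iff_iso_limit:
  "is_limit A B F L p \<longleftrightarrow>
     is_cone A B F L p \<and> (\<exists>M q. is_limit A B F M q \<and> cone_iso A B L p M q)"
proof
  assume lim: "is_limit A B F L p"
  then have cone: "is_cone A B F L p"
    by (simp add: is_limit_def)
  have id: "Ident B L \<in> hom B L L"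
    using cone B.ident_hom by (simp add: is_cone_def)
  have "Ident B L \<in> cone_hom A B L p L p"
    using cone id B.comp_ident by (auto simp: cone_hom_def is_cone_def)
  then have "cone_iso A B L p L p"
    using B.comp_ident[OF id] by (auto simp: cone_iso_def)
  then show "is_cone A B F L p \<and> (\<exists>M q. is_limit A B F M q \<and> cone_iso A B L p M q)"
    using lim cone by blast
next
  assume "is_cone A B F L p \<and> (\<exists>M q. is_limit A B F M q \<and> cone_iso A B L p M q)"
  then obtain M q f g where p: "is_cone A B F L p" and lim: "is_limit A B F M q"
    and f: "f \<in> cone_hom A B L p M q" and g: "g \<in> cone_hom A B M q L p"
    and gf: "g \<cdot>\<^bsub>B\<^esub> f = Ident B L"
    unfolding cone_iso_def by blast
  have q: "is_cone A B F M q"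
    using lim by (simp add: is_limit_def)
  have "\<exists>!h. h \<in> cone_hom A B N r L p" if r: "is_cone A B F N r" for N r
  proof -
    obtain h where h: "h \<in> cone_hom A B N r M q"
      and uniq: "\<And>h'. h' \<in> cone_hom A B N r M q \<Longrightarrow> h' = h"
      using lim r unfolding is_limit_def by blast
    show ?thesis
    proof (rule ex1I[of _ "g \<cdot>\<^bsub>B\<^esub> h"])
      show "g \<cdot>\<^bsub>B\<^esub> h \<in> cone_hom A B N r L p"
        by (rule cone_hom_comp[OF r q p h g])
    next
      fix k assume k: "k \<in> cone_hom A B N r L p"
      have homs: "k \<in> hom B N L" "f \<in> hom B L M" "g \<in> hom B M L"
        using k f g by (auto simp: cone_hom_def)
      have "f \<cdot>\<^bsub>B\<^esub> k = h"
        by (rule uniq[OF cone_hom_comp[OF r p q k f]])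
      then have "g \<cdot>\<^bsub>B\<^esub> h = (g \<cdot>\<^bsub>B\<^esub> f) \<cdot>\<^bsub>B\<^esub> k"
        using B.comp_assoc_hom[OF homs] by simp
      then show "k = g \<cdot>\<^bsub>B\<^esub> h"
        using gf B.ident_comp[OF homs(1)] by simp
    qed
  qed
  then show "is_limit A B F L p"
    using p by (simp add: is_limit_def)
qed

end

section \<open>The leading index of an object of the gluing data category\<close>

fun first_letter :: "'i word \<Rightarrow> 'i" where
  "first_letter (W1 i) = i"
| "first_letter (W2 i j) = i"
| "first_letter (W3 i j k) = i"

lemma first_letter_word_eq: "(v, w) \<in> word_eq I \<Longrightarrow> first_letter v = first_letter w"
  by (induction rule: word_eq.induct) auto

text \<open>The word is an arbitrary representative; by the previous lemma all words of a class have the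
  same first letter.\<close>

definition lead :: "'i gobj \<Rightarrow> 'i" where
  "lead a = first_letter (SOME w. w \<in> a)"

lemma lead_class:
  assumes "w \<in> words I"
  shows "lead (word_eq I `` {w}) = first_letter w"
proof -
  have "w \<in> word_eq I `` {w}"
    using assms by (simp add: word_eq.refl)
  then have "(SOME v. v \<in> word_eq I `` {w}) \<in> word_eq I `` {w}"
    by (rule someI)
  then show ?thesis
    unfolding lead_def by (simp add: first_letter_word_eq)
qed

lemma lead_cls:
  "i \<in> I \<Longrightarrow> lead (cls1 I i) = i"
  "i \<in> I \<Longrightarrow> j \<in> I \<Longrightarrow> lead (cls2 I i j) = i"
  "i \<in> I \<Longrightarrow> j \<in> I \<Longrightarrow> k \<in> I \<Longrightarrow> lead (cls3 I i j k) = i"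
  by (simp_all add: cls1_def cls2_def cls3_def lead_class words_def)

lemma GLD_obj_cases:
  assumes "a \<in> Obj (GLD I)"
  obtains (one) i where "i \<in> I" "a = cls1 I i"
  | (two) i j where "i \<in> I" "j \<in> I" "a = cls2 I i j"
  | (three) i j k where "i \<in> I" "j \<in> I" "k \<in> I" "a = cls3 I i j k"
proof -
  obtain w where w: "w \<in> words I" "a = word_eq I `` {w}"
    using assms by (auto simp: GLD_def elim: quotientE)
  show thesis
  proof (cases w)
    case (W1 i)
    show thesis
      by (rule one[of i]) (use w W1 in \<open>simp_all add: words_def cls1_def\<close>)
  next
    case (W2 i j)
    show thesis
      by (rule two[of i j]) (use w W2 in \<open>simp_all add: words_def cls2_def\<close>)
  next
    case (W3 i j k)
    show thesis
      by (rule three[of i j k]) (use w W3 in \<open>simp_all add: words_def cls3_def\<close>)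
  qed
qed

lemma cls1_to_cls2: "i \<in> I \<Longrightarrow> j \<in> I \<Longrightarrow> (cls1 I i, cls2 I i j) \<in> gmors I"
  using gmors.eta1[of i I j] by (simp add: eta1_def)

lemma cls2_to_cls3:
  "i \<in> I \<Longrightarrow> j \<in> I \<Longrightarrow> k \<in> I \<Longrightarrow> n \<in> {j, k} \<Longrightarrow> (cls2 I i n, cls3 I i j k) \<in> gmors I"
  using gmors.eta2[of i I j k n] by (simp add: eta2_def)

lemma cls2_swap: "i \<in> I \<Longrightarrow> j \<in> I \<Longrightarrow> (cls2 I j i, cls2 I i j) \<in> gmors I"
  using gmors.tau2[of i I j] by (simp add: tau2_def)

lemma cls1_to_cls3:
  "i \<in> I \<Longrightarrow> j \<in> I \<Longrightarrow> k \<in> I \<Longrightarrow> (cls1 I i, cls3 I i j k) \<in> gmors I"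
  by (rule gmors.comp[OF cls1_to_cls2 cls2_to_cls3[of i I j k j]]) auto

lemma cls1_to_cls1: "i \<in> I \<Longrightarrow> (cls1 I i, cls1 I i) \<in> gmors I"
  using cls_obj(1)[of i I] gmors.ident[of "cls1 I i" I] by (simp add: GLD_def)

lemma from_lead:
  assumes "a \<in> Obj (GLD I)"
  shows "lead a \<in> I" and "(cls1 I (lead a), a) \<in> gmors I"
proof -
  have "lead a \<in> I \<and> (cls1 I (lead a), a) \<in> gmors I"
    using assms
    by (cases rule: GLD_obj_cases)
      (simp_all add: lead_cls cls1_to_cls1 cls1_to_cls2 cls1_to_cls3)
  then show "lead a \<in> I" and "(cls1 I (lead a), a) \<in> gmors I"
    by blast+
qed

lemma tau2_comp_eta1:
  "tau2 I i j \<cdot>\<^bsub>GLD I\<^esub> eta1 I j i = (cls1 I j, cls2 I i j)"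
  by (simp add: GLD_def tau2_def eta1_def)

lemma hom_GLD: "f \<in> hom (GLD I) a b \<longleftrightarrow> f = (a, b) \<and> (a, b) \<in> gmors I"
  by (cases f) (auto simp: hom_def GLD_def)

section \<open>Cones over a functor on the gluing data category\<close>

locale GLD_functor = cat_functor "GLD I" C G
  for I :: "'i set" and C :: "('o, 'm) cat"
    and G :: "('i gobj, 'i gmor, 'o, 'm) fctr"
begin

lemma amap_gmor: "(a, b) \<in> gmors I \<Longrightarrow> amap G (a, b) \<in> hom C (omap G a) (omap G b)"
  by (rule amap_hom) (simp add: hom_GLD)

text \<open>Since a composite in \<open>GLD I\<close> is determined by its endpoints, the intermediate object \<open>b\<close>
  disappears; used in both directions, this reroutes a path through another object.\<close>

lemma amap_path:
  assumes "(a, b) \<in> gmors I" "(b, c) \<in> gmors I" "x \<in> hom C L (omap G a)"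
  shows "amap G (b, c) \<cdot>\<^bsub>C\<^esub> (amap G (a, b) \<cdot>\<^bsub>C\<^esub> x) = amap G (a, c) \<cdot>\<^bsub>C\<^esub> x"
proof -
  have "amap G (a, c) = amap G (b, c) \<cdot>\<^bsub>C\<^esub> amap G (a, b)"
    using amap_comp[of "(a, b)" a b "(b, c)" c] assms by (simp add: hom_GLD) (simp add: GLD_def)
  then show ?thesis
    using B.comp_assoc_hom[OF assms(3) amap_gmor[OF assms(1)] amap_gmor[OF assms(2)]] by simp
qed

lemma amap_id:
  assumes "a \<in> Obj (GLD I)" "x \<in> hom C L (omap G a)"
  shows "amap G (a, a) \<cdot>\<^bsub>C\<^esub> x = x"
  using amap_ident[OF assms(1)] B.ident_comp[OF assms(2)] by (simp add: GLD_def)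

text \<open>A family \<open>x\<close> is matching if it is a cone over the diagram of the cospans
  \<open>G(i) \<rightarrow> G([i,j]) \<leftarrow> G(j)\<close>.\<close>

definition matching :: "'o \<Rightarrow> ('i \<Rightarrow> 'm) \<Rightarrow> bool" where
  "matching L x \<longleftrightarrow>
     (\<forall>i\<in>I. x i \<in> hom C L (omap G (cls1 I i))) \<and>
     (\<forall>i\<in>I. \<forall>j\<in>I.
        amap G (eta1 I i j) \<cdot>\<^bsub>C\<^esub> x i = amap G (tau2 I i j \<cdot>\<^bsub>GLD I\<^esub> eta1 I j i) \<cdot>\<^bsub>C\<^esub> x j)"

lemma matching_iff:
  "matching L x \<longleftrightarrow>
     (\<forall>i\<in>I. x i \<in> hom C L (omap G (cls1 I i))) \<and>
     (\<forall>i\<in>I. \<forall>j\<in>I.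
        amap G (cls1 I i, cls2 I i j) \<cdot>\<^bsub>C\<^esub> x i = amap G (cls1 I j, cls2 I i j) \<cdot>\<^bsub>C\<^esub> x j)"
  unfolding matching_def tau2_comp_eta1 by (simp only: eta1_def)

definition extend :: "('i \<Rightarrow> 'm) \<Rightarrow> 'i gobj \<Rightarrow> 'm" where
  "extend x a = amap G (cls1 I (lead a), a) \<cdot>\<^bsub>C\<^esub> x (lead a)"

lemma matching_hom: "matching L x \<Longrightarrow> i \<in> I \<Longrightarrow> x i \<in> hom C L (omap G (cls1 I i))"
  by (simp add: matching_def)

lemma matching_swap:
  "matching L x \<Longrightarrow> i \<in> I \<Longrightarrow> j \<in> I \<Longrightarrow>
     amap G (cls1 I i, cls2 I i j) \<cdot>\<^bsub>C\<^esub> x i = amap G (cls1 I j, cls2 I i j) \<cdot>\<^bsub>C\<^esub> x j"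
  unfolding matching_iff by blast

lemma extend_hom:
  assumes "matching L x" "a \<in> Obj (GLD I)"
  shows "extend x a \<in> hom C L (omap G a)"
  unfolding extend_def
  by (rule B.comp_hom[OF matching_hom[OF assms(1)] amap_gmor])
    (use from_lead[OF assms(2)] in auto)

lemma extend_cls1: "matching L x \<Longrightarrow> i \<in> I \<Longrightarrow> extend x (cls1 I i) = x i"
  unfolding extend_def lead_cls(1) by (rule amap_id[OF cls_obj(1) matching_hom])

text \<open>Pushing the extension along \<open>a \<rightarrow> b\<close> amounts to comparing, at \<open>b\<close>, the member of the family at
  the leading index of \<open>a\<close> with the one at the leading index of \<open>b\<close>. There is nothing to compare
  when the two indices coincide, which is the case for all \<open>\<eta>\<close>.\<close>

lemma amap_extend:
  assumes "matching L x" "(a, b) \<in> gmors I"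
  shows "amap G (a, b) \<cdot>\<^bsub>C\<^esub> extend x a = amap G (cls1 I (lead a), b) \<cdot>\<^bsub>C\<^esub> x (lead a)"
proof -
  have a: "a \<in> Obj (GLD I)"
    using gmors_obj[OF assms(2)] by simp
  show ?thesis
    unfolding extend_def
    by (rule amap_path[OF from_lead(2)[OF a] assms(2) matching_hom[OF assms(1) from_lead(1)[OF a]]])
qed

lemma amap_extend_same_lead:
  assumes "matching L x" "(a, b) \<in> gmors I" "lead a = lead b"
  shows "amap G (a, b) \<cdot>\<^bsub>C\<^esub> extend x a = extend x b"
  using amap_extend[OF assms(1,2)] assms(3) by (simp add: extend_def)

text \<open>Naturality of the extension only has to be checked on the generating morphisms. For a triple
  transition, \<open>[j] \<rightarrow> [i,j,k]\<close> is factored through \<open>[i,j]\<close>, where the matching condition applies.\<close>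

lemma amap_extend_eq:
  assumes m: "matching L x" and "(a, b) \<in> gmors I"
  shows "amap G (a, b) \<cdot>\<^bsub>C\<^esub> extend x a = extend x b"
  using assms(2)
proof (induction "(a, b)" arbitrary: a b rule: gmors.induct)
  case (ident a)
  then show ?case
    using amap_extend_same_lead[OF m gmors.ident] by blast
next
  case (eta1 i j)
  then have "lead a = lead b"
    by (auto simp: eta1_def lead_cls)
  then show ?case
    using amap_extend_same_lead[OF m, of a b] gmors.eta1[of i I j] eta1 by simp
next
  case (eta2 i j k n)
  then have "n \<in> I"
    by auto
  then have "lead a = lead b"
    using eta2 by (auto simp: eta2_def lead_cls)
  then show ?case
    using amap_extend_same_lead[OF m, of a b] gmors.eta2[of i I j k n] eta2 by simp
next
  case (tau2 i j)
  then have ij: "i \<in> I" "j \<in> I" and a: "a = cls2 I j i" and b: "b = cls2 I i j"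
    by (auto simp: tau2_def)
  have "amap G (a, b) \<cdot>\<^bsub>C\<^esub> extend x a = amap G (cls1 I j, b) \<cdot>\<^bsub>C\<^esub> x j"
    using amap_extend[OF m cls2_swap[OF ij]] ij by (simp add: a b lead_cls)
  also have "\<dots> = extend x b"
    using matching_swap[OF m ij] ij by (simp add: b extend_def lead_cls)
  finally show ?case .
next
  case (tau3 i j k)
  then have ijk: "i \<in> I" "j \<in> I" "k \<in> I" and a: "a = cls3 I j i k" and b: "b = cls3 I i j k"
    by (auto simp: tau3_def)
  have j_ij: "(cls1 I j, cls2 I i j) \<in> gmors I"
    by (rule gmors.comp[OF cls1_to_cls2 cls2_swap]) (use ijk in auto)
  have i_ij: "(cls1 I i, cls2 I i j) \<in> gmors I"
    by (rule cls1_to_cls2[OF ijk(1,2)])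
  have ij_b: "(cls2 I i j, b) \<in> gmors I"
    unfolding b by (rule cls2_to_cls3) (use ijk in auto)
  have "(a, b) \<in> gmors I"
    using gmors.tau3[OF ijk] by (simp add: tau3_def a b)
  then have "amap G (a, b) \<cdot>\<^bsub>C\<^esub> extend x a = amap G (cls1 I j, b) \<cdot>\<^bsub>C\<^esub> x j"
    using amap_extend[OF m] ijk by (simp add: a lead_cls)
  also have "\<dots> = amap G (cls2 I i j, b) \<cdot>\<^bsub>C\<^esub> (amap G (cls1 I j, cls2 I i j) \<cdot>\<^bsub>C\<^esub> x j)"
    by (rule amap_path[OF j_ij ij_b matching_hom[OF m ijk(2)], symmetric])
  also have "\<dots> = amap G (cls2 I i j, b) \<cdot>\<^bsub>C\<^esub> (amap G (cls1 I i, cls2 I i j) \<cdot>\<^bsub>C\<^esub> x i)"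
    using matching_swap[OF m ijk(1,2)] by simp
  also have "\<dots> = amap G (cls1 I i, b) \<cdot>\<^bsub>C\<^esub> x i"
    by (rule amap_path[OF i_ij ij_b matching_hom[OF m ijk(1)]])
  finally show ?case
    using ijk by (simp add: b extend_def lead_cls)
next
  case (comp a b c)
  have "a \<in> Obj (GLD I)"
    using gmors_obj[OF comp.hyps(1)] by blast
  then show ?case
    using amap_path[OF comp.hyps(1,3) extend_hom[OF m]] comp.hyps(2,4) by simp
qed

lemma cone_extend:
  assumes "L \<in> Obj C" "matching L x"
  shows "is_cone (GLD I) C G L (extend x)"
  using assms extend_hom amap_extend_eq by (auto simp: is_cone_def hom_GLD)

lemma cone_amap:
  "is_cone (GLD I) C G L q \<Longrightarrow> (a, b) \<in> gmors I \<Longrightarrow> amap G (a, b) \<cdot>\<^bsub>C\<^esub> q a = q b"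
  by (auto simp: is_cone_def hom_GLD)

lemma cone_matching:
  assumes "is_cone (GLD I) C G L q"
  shows "matching L (\<lambda>i. q (cls1 I i))"
proof -
  have "amap G (cls1 I i, cls2 I i j) \<cdot>\<^bsub>C\<^esub> q (cls1 I i) =
      amap G (cls1 I j, cls2 I i j) \<cdot>\<^bsub>C\<^esub> q (cls1 I j)" if "i \<in> I" "j \<in> I" for i j
  proof -
    have "(cls1 I j, cls2 I i j) \<in> gmors I"
      by (rule gmors.comp[OF cls1_to_cls2 cls2_swap]) (use that in auto)
    then show ?thesis
      using cone_amap[OF assms cls1_to_cls2[OF that]] cone_amap[OF assms] by simp
  qed
  moreover have "q (cls1 I i) \<in> hom C L (omap G (cls1 I i))" if "i \<in> I" for i
    using assms cls_obj(1)[OF that] by (simp add: is_cone_def)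
  ultimately show ?thesis
    unfolding matching_iff by blast
qed

lemma is_cone_cong:
  assumes "\<And>a. a \<in> Obj (GLD I) \<Longrightarrow> p a = q a"
  shows "is_cone (GLD I) C G L p \<longleftrightarrow> is_cone (GLD I) C G L q"
proof -
  have "amap G (a, b) \<cdot>\<^bsub>C\<^esub> p a = p b \<longleftrightarrow> amap G (a, b) \<cdot>\<^bsub>C\<^esub> q a = q b"
    if "(a, b) \<in> gmors I" for a b
    using gmors_obj[OF that] assms by simp
  then show ?thesis
    using assms by (auto simp: is_cone_def hom_GLD)
qed

text \<open>The two equalities unfold the components at \<open>[i,j]\<close> and \<open>[i,j,k]\<close> back to the one at
  \<open>[i]\<close>, so they make \<open>p\<close> the extension of a matching family.\<close>

lemma is_cone_iff_matching:
  assumes "L \<in> Obj C" and p: "\<And>a. a \<in> Obj (GLD I) \<Longrightarrow> p a \<in> hom C L (omap G a)"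
  shows "is_cone (GLD I) C G L p \<longleftrightarrow>
    (\<forall>i\<in>I. \<forall>j\<in>I. p (cls2 I i j) = amap G (eta1 I i j) \<cdot>\<^bsub>C\<^esub> p (cls1 I i)) \<and>
    (\<forall>i\<in>I. \<forall>j\<in>I. \<forall>k\<in>I. \<forall>n\<in>{j, k}.
       p (cls3 I i j k) = amap G (eta2 I i n j k) \<cdot>\<^bsub>C\<^esub> p (cls2 I i n)) \<and>
    matching L (\<lambda>i. p (cls1 I i))" (is "_ \<longleftrightarrow> ?one \<and> ?two \<and> ?match")
proof
  assume cone: "is_cone (GLD I) C G L p"
  show "?one \<and> ?two \<and> ?match"
    using cone_matching[OF cone] cone_amap[OF cone cls1_to_cls2] cone_amap[OF cone cls2_to_cls3]
    by (simp add: eta1_def eta2_def)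
next
  assume *: "?one \<and> ?two \<and> ?match"
  then have one: "p (cls2 I i j) = amap G (cls1 I i, cls2 I i j) \<cdot>\<^bsub>C\<^esub> p (cls1 I i)"
    if "i \<in> I" "j \<in> I" for i j
    using that by (simp add: eta1_def)
  have two: "p (cls3 I i j k) = amap G (cls2 I i j, cls3 I i j k) \<cdot>\<^bsub>C\<^esub> p (cls2 I i j)"
    if "i \<in> I" "j \<in> I" "k \<in> I" for i j k
    using * that by (simp add: eta2_def)
  have match: ?match
    using * by blast
  have "p a = extend (\<lambda>i. p (cls1 I i)) a" if "a \<in> Obj (GLD I)" for a
    using that
  proof (cases rule: GLD_obj_cases)
    case (one i)
    then show ?thesis
      using extend_cls1[OF match] by simp
  next
    case (two i j)
    then show ?thesis
      by (simp add: extend_def lead_cls one)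
  next
    case (three i j k)
    have "amap G (cls2 I i j, a) \<cdot>\<^bsub>C\<^esub> (amap G (cls1 I i, cls2 I i j) \<cdot>\<^bsub>C\<^esub> p (cls1 I i)) =
        amap G (cls1 I i, a) \<cdot>\<^bsub>C\<^esub> p (cls1 I i)"
      unfolding three(4)
      by (rule amap_path[OF cls1_to_cls2 cls2_to_cls3 p[OF cls_obj(1)]]) (use three in auto)
    then show ?thesis
      using three by (simp add: extend_def lead_cls one two)
  qed
  then show "is_cone (GLD I) C G L p"
    using is_cone_cong cone_extend[OF assms(1) match] by blast
qed

section \<open>Limits as universal matching families\<close>

text \<open>Both cones are determined by their components at the objects \<open>[i]\<close> through composition with
  the same \<open>G([i] \<rightarrow> a)\<close>, and associativity moves \<open>f\<close> past that morphism.\<close>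

lemma cone_hom_iff:
  assumes q: "is_cone (GLD I) C G N q" and p: "is_cone (GLD I) C G L p"
  shows "f \<in> cone_hom (GLD I) C N q L p \<longleftrightarrow>
    f \<in> hom C N L \<and> (\<forall>i\<in>I. p (cls1 I i) \<cdot>\<^bsub>C\<^esub> f = q (cls1 I i))"
proof
  assume "f \<in> cone_hom (GLD I) C N q L p"
  then show "f \<in> hom C N L \<and> (\<forall>i\<in>I. p (cls1 I i) \<cdot>\<^bsub>C\<^esub> f = q (cls1 I i))"
    by (simp add: cone_hom_def cls_obj)
next
  assume *: "f \<in> hom C N L \<and> (\<forall>i\<in>I. p (cls1 I i) \<cdot>\<^bsub>C\<^esub> f = q (cls1 I i))"
  have "p a \<cdot>\<^bsub>C\<^esub> f = q a" if a: "a \<in> Obj (GLD I)" for a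
  proof -
    let ?i = "cls1 I (lead a)"
    have "p ?i \<in> hom C L (omap G ?i)"
      using p cls_obj(1)[OF from_lead(1)[OF a]] by (simp add: is_cone_def)
    then have "(amap G (?i, a) \<cdot>\<^bsub>C\<^esub> p ?i) \<cdot>\<^bsub>C\<^esub> f = amap G (?i, a) \<cdot>\<^bsub>C\<^esub> (p ?i \<cdot>\<^bsub>C\<^esub> f)"
      using B.comp_assoc * amap_gmor[OF from_lead(2)[OF a]] by blast
    then show ?thesis
      using * from_lead[OF a] by (simp add: cone_amap[OF p] cone_amap[OF q])
  qed
  then show "f \<in> cone_hom (GLD I) C N q L p"
    using * by (simp add: cone_hom_def)
qed

text \<open>Restriction to the objects \<open>[i]\<close> and extension turn a test cone into a test family and back;
  by the previous lemma the mediating morphisms are the same on both sides.\<close>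

lemma is_limit_iff_universal_matching:
  "is_limit (GLD I) C G L p \<longleftrightarrow>
     is_cone (GLD I) C G L p \<and>
     (\<forall>N\<in>Obj C. \<forall>x. matching N x \<longrightarrow>
        (\<exists>!\<mu>. \<mu> \<in> hom C N L \<and> (\<forall>i\<in>I. p (cls1 I i) \<cdot>\<^bsub>C\<^esub> \<mu> = x i)))"
proof (cases "is_cone (GLD I) C G L p")
  case p: True
  show ?thesis
  proof
    assume lim: "is_limit (GLD I) C G L p"
    have "\<exists>!\<mu>. \<mu> \<in> hom C N L \<and> (\<forall>i\<in>I. p (cls1 I i) \<cdot>\<^bsub>C\<^esub> \<mu> = x i)"
      if N: "N \<in> Obj C" and x: "matching N x" for N x
    proof -
      have cone: "is_cone (GLD I) C G N (extend x)"
        by (rule cone_extend[OF N x])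
      have "\<exists>!\<mu>. \<mu> \<in> cone_hom (GLD I) C N (extend x) L p"
        using lim cone by (simp add: is_limit_def)
      then show ?thesis
        by (simp add: cone_hom_iff[OF cone p] extend_cls1[OF x])
    qed
    then show "is_cone (GLD I) C G L p \<and>
      (\<forall>N\<in>Obj C. \<forall>x. matching N x \<longrightarrow>
        (\<exists>!\<mu>. \<mu> \<in> hom C N L \<and> (\<forall>i\<in>I. p (cls1 I i) \<cdot>\<^bsub>C\<^esub> \<mu> = x i)))"
      using p by blast
  next
    assume univ: "is_cone (GLD I) C G L p \<and>
      (\<forall>N\<in>Obj C. \<forall>x. matching N x \<longrightarrow>
        (\<exists>!\<mu>. \<mu> \<in> hom C N L \<and> (\<forall>i\<in>I. p (cls1 I i) \<cdot>\<^bsub>C\<^esub> \<mu> = x i)))"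
    have "\<exists>!\<mu>. \<mu> \<in> cone_hom (GLD I) C N q L p" if q: "is_cone (GLD I) C G N q" for N q
    proof -
      have "N \<in> Obj C"
        using q by (simp add: is_cone_def)
      then show ?thesis
        unfolding cone_hom_iff[OF q p] using univ cone_matching[OF q] by blast
    qed
    then show "is_limit (GLD I) C G L p"
      using p by (simp add: is_limit_def)
  qed
qed (simp add: is_limit_def)

lemma glued_up_iff_is_limit: "glued_up I C G L p \<longleftrightarrow> is_limit (GLD I) C G L p"
  unfolding glued_up_def by (rule is_limit_iff_iso_limit[symmetric])

end

theorem theorem2p8:
  fixes I :: "'i set"
    and C :: "('o, 'm) cat"
    and G :: "('i gobj, 'i gmor, 'o, 'm) fctr"
    and L :: 'o
    and p :: "'i gobj \<Rightarrow> 'm"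
  assumes "category C"
    and "gluing_data_functor I C G"
    and "L \<in> Obj C"
    and "\<And>a. a \<in> Obj (GLD I) \<Longrightarrow> p a \<in> hom C L (omap G a)"
  shows "glued_up I C G L p \<longleftrightarrow>
    (\<forall>i\<in>I. \<forall>j\<in>I. p (cls2 I i j) = amap G (eta1 I i j) \<cdot>\<^bsub>C\<^esub> p (cls1 I i)) \<and>
    (\<forall>i\<in>I. \<forall>j\<in>I. \<forall>k\<in>I. \<forall>n\<in>{j, k}.
       p (cls3 I i j k) = amap G (eta2 I i n j k) \<cdot>\<^bsub>C\<^esub> p (cls2 I i n)) \<and>
    ((\<forall>i\<in>I. \<forall>j\<in>I.
        amap G (eta1 I i j) \<cdot>\<^bsub>C\<^esub> p (cls1 I i) =
        amap G (tau2 I i j \<cdot>\<^bsub>GLD I\<^esub> eta1 I j i) \<cdot>\<^bsub>C\<^esub> p (cls1 I j)) \<and>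
     (\<forall>L'\<in>Obj C. \<forall>p'.
        (\<forall>i\<in>I. p' i \<in> hom C L' (omap G (cls1 I i))) \<and>
        (\<forall>i\<in>I. \<forall>j\<in>I.
           amap G (eta1 I i j) \<cdot>\<^bsub>C\<^esub> p' i =
           amap G (tau2 I i j \<cdot>\<^bsub>GLD I\<^esub> eta1 I j i) \<cdot>\<^bsub>C\<^esub> p' j) \<longrightarrow>
        (\<exists>!\<mu>. \<mu> \<in> hom C L' L \<and> (\<forall>i\<in>I. p (cls1 I i) \<cdot>\<^bsub>C\<^esub> \<mu> = p' i))))"
proof -
  interpret gluing_data_functor I C G
    by (rule assms(2))
  interpret GLD_functor I C G
    by unfold_locales
  have match: "matching L (\<lambda>i. p (cls1 I i)) \<longleftrightarrow> (\<forall>i\<in>I. \<forall>j\<in>I.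
      amap G (eta1 I i j) \<cdot>\<^bsub>C\<^esub> p (cls1 I i) =
      amap G (tau2 I i j \<cdot>\<^bsub>GLD I\<^esub> eta1 I j i) \<cdot>\<^bsub>C\<^esub> p (cls1 I j))"
    unfolding matching_def using assms(4)[OF cls_obj(1)] by blast
  show ?thesis
    unfolding glued_up_iff_is_limit is_limit_iff_universal_matching
    by (simp only: is_cone_iff_matching[OF assms(3,4)] match conj_assoc) (simp only: matching_def)
qed

end
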